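(* Let $k\ge1$ and $n\ge1$. The set $\mathcal{B}_n(k+1)$ of $(k+1)$-bundled increasing trees of order $n$ is in bijection with the set $\overline{\mathcal{Q}}_n(k)$ of $k$-bundled Stirling permutations of order $n$.
   Context: A $k$-bundled Stirling permutation of order $n$ is a permutation of the multiset $\{1^k,2^{k+2},\dots,n^{k+2}\}$ (the value $1$ occurring $k$ times and each of $2,\dots,n$ occurring $k+2$ times) such that for each $i$ every entry occurring between two occurrences of $i$ is at least $i$. A $(k+1)$-bundled increasing tree of order $n$ is a rooted tree with vertex set $\{1,\dots,n\}$, root $1$, labels increasing along every path away from the root, in which every vertex has $k+1$ ordered bundles (positions $1,\dots,k+1$), each bundle containing a (possibly empty) linearly ordered sequence of children of that vertex; each non-root vertex lies in exactly one bundle of its parent. *)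

theory Defs
  imports "HOL-Combinatorics.Multiset_Permutations"
begin

section \<open>Bundled Stirling permutations\<close>

definition bundled_stirling_mset :: "nat \<Rightarrow> nat \<Rightarrow> nat multiset" where
  "bundled_stirling_mset k n =
     replicate_mset k 1 + (\<Sum>i\<in>{2..n}. replicate_mset (k + 2) i)"

definition bundled_stirling_perms :: "nat \<Rightarrow> nat \<Rightarrow> nat list set" where
  "bundled_stirling_perms k n =
     {w \<in> permutations_of_multiset (bundled_stirling_mset k n).
        \<forall>p q r. p < q \<and> q < r \<and> r < length w \<and> w ! p = w ! r \<longrightarrow> w ! p \<le> w ! q}"

section \<open>Bundled increasing trees\<close>

text \<open>
  A node carries its label and the list of its bundles; the bundle in position
  \<open>j + 1\<close> is \<open>bundles t ! j\<close>, a list of child trees. Two terms are equal exactly if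
  they describe the same labelled tree with the same distribution of the children into
  ordered bundles. In particular a vertex may have empty bundles, and the positions of
  these matter.
\<close>

datatype bundled_tree = Node (label: nat) (bundles: "bundled_tree list list")

text \<open>
  The subtrees rooted at the vertices of a tree, listed in preorder, one entry per vertex;
  repeated labels would hence show up as repetitions in \<open>vertices\<close>.
\<close>

primrec subtrees :: "bundled_tree \<Rightarrow> bundled_tree list" where
  "subtrees (Node v bs) = Node v bs # concat (map concat (map (map subtrees) bs))"

definition vertices :: "bundled_tree \<Rightarrow> nat list" where
  "vertices t = map label (subtrees t)"

definition children :: "bundled_tree \<Rightarrow> bundled_tree list" where
  "children t = concat (bundles t)"

definition increasing :: "bundled_tree \<Rightarrow> bool" where
  "increasing t \<longleftrightarrow>
     (\<forall>s\<in>set (subtrees t). \<forall>c\<in>set (children s). label s < label c)"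

definition bundled_increasing_trees :: "nat \<Rightarrow> nat \<Rightarrow> bundled_tree set" where
  "bundled_increasing_trees m n =
     {t. distinct (vertices t) \<and> set (vertices t) = {1..n} \<and> label t = 1 \<and> increasing t \<and>
         (\<forall>s\<in>set (subtrees t). length (bundles s) = m)}"

end

(* Code a vertex v with bundles B_1, ..., B_{k+1} by v W(B_1) v W(B_2) v ... W(B_{k+1}) v, where
   W(B) concatenates the codes of the children in B. Every label then occurs k+2 times, and the
   word of the tree is the code of its root without the first and last letter, which leaves k
   ones. Since labels increase, v does not occur in any W(B_i), so v and its k+2 occurrences
   delimit the code and its bundles: the coding of forests is injective. Conversely, a nonempty
   Stirling word with all multiplicities k+2 is cut at the last occurrence of its first letter a,
   and the part before at all occurrences of a; the Stirling condition makes the letters of each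
   piece disjoint from the rest of the word, so that each piece again has multiplicities k+2. *)

theory Submission
  imports Defs "HOL-Library.Sublist"
begin

section \<open>Words cut at the occurrences of a letter\<close>

definition separated :: "'a \<Rightarrow> 'a list list \<Rightarrow> 'a list" where
  "separated a ss = a # concat (map (\<lambda>s. s @ [a]) ss)"

lemma separated_Nil [simp]: "separated a [] = [a]"
  by (simp add: separated_def)

lemma separated_Cons: "separated a (s # ss) = a # s @ separated a ss"
  by (simp add: separated_def)

lemma separated_append: "separated a (ss @ ts) = separated a ss @ concat (map (\<lambda>s. s @ [a]) ts)"
  by (simp add: separated_def)

lemma separated_eq_snoc: "\<exists>x. separated a ss = x @ [a]"
  by (induction ss) (auto simp: separated_Cons)

lemma set_separated: "set (separated a ss) = insert a (\<Union>s\<in>set ss. set s)"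
  by (auto simp: separated_def)

lemma count_list_concat: "count_list (concat xss) x = (\<Sum>xs\<leftarrow>xss. count_list xs x)"
  by (induction xss) auto

lemma count_list_separated:
  "count_list (separated a ss) x =
     (\<Sum>s\<leftarrow>ss. count_list s x) + (if x = a then Suc (length ss) else 0)"
  by (induction ss) (auto simp: separated_Cons)

text \<open>Induction from the left: a letter \<open>a\<close> opens a new empty piece in front, any
  other letter joins the first piece, which exists by the length formula.\<close>

lemma exists_separated:
  "\<exists>ss. a # u @ [a] = separated a ss \<and> (\<forall>s\<in>set ss. a \<notin> set s) \<and> length ss = Suc (count_list u a)"
proof (induction u)
  case Nil
  show ?case by (rule exI[of _ "[[]]"]) (simp add: separated_Cons)
next
  case (Cons b u)
  then obtain ss where ss: "a # u @ [a] = separated a ss" "\<forall>s\<in>set ss. a \<notin> set s"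
      "length ss = Suc (count_list u a)" by blast
  show ?case
  proof (cases "b = a")
    case True
    then show ?thesis using ss
      by (intro exI[of _ "[] # ss"]) (simp add: separated_Cons)
  next
    case False
    obtain s ss' where "ss = s # ss'" using ss(3) by (cases ss) auto
    then show ?thesis using ss False
      by (intro exI[of _ "(b # s) # ss'"]) (simp add: separated_Cons)
  qed
qed

text \<open>
  The number of pieces is needed: it tells which occurrence of \<open>a\<close> ends the left part.
\<close>

lemma separated_prefix_code:
  assumes "separated a ss @ x = separated a ts @ y" "length ss = length ts"
    and "\<forall>s\<in>set ss. a \<notin> set s" "\<forall>s\<in>set ts. a \<notin> set s"
  shows "ss = ts \<and> x = y"
  using assms
proof (induction ss arbitrary: ts)
  case Nil
  then show ?case by auto
next
  case (Cons s ss)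
  obtain t ts' where ts: "ts = t # ts'" using Cons.prems(2) by (cases ts) auto
  have eq: "s @ separated a ss @ x = t @ separated a ts' @ y"
    using Cons.prems(1) by (simp add: ts separated_Cons)
  \<comment> \<open>The word after the first piece starts with \<open>a\<close>, so on each side
    \<open>takeWhile\<close> stops exactly at the end of that piece.\<close>
  have "takeWhile (\<lambda>x. x \<noteq> a) (s @ separated a ss @ x) = s"
    using Cons.prems(3) by (subst takeWhile_append2) (auto simp: separated_def)
  moreover have "takeWhile (\<lambda>x. x \<noteq> a) (t @ separated a ts' @ y) = t"
    using Cons.prems(4) by (subst takeWhile_append2) (auto simp: ts separated_def)
  ultimately have "s = t" by (simp add: eq)
  then show ?case using Cons.IH[of ts'] Cons.prems(2-4) eq by (simp add: ts)
qed

section \<open>Stirling words\<close>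

definition stirling :: "'a::linorder list \<Rightarrow> bool" where
  "stirling w \<longleftrightarrow> (\<forall>a b. subseq [a, b, a] w \<longrightarrow> a \<le> b)"

lemma subseq_triple_iff:
  "subseq [a, b, c] w \<longleftrightarrow>
     (\<exists>p q r. p < q \<and> q < r \<and> r < length w \<and> w ! p = a \<and> w ! q = b \<and> w ! r = c)"
proof
  assume "subseq [a, b, c] w"
  then obtain x y z u where w: "w = x @ a # y @ b # z @ c # u"
    by (auto dest!: list_emb_ConsD)
  let ?p = "length x" and ?q = "Suc (length x + length y)"
  let ?r = "Suc (Suc (length x + length y + length z))"
  have "w ! ?p = a" "w ! ?q = b" "w ! ?r = c" "?r < length w"
    by (auto simp: w nth_append)
  moreover have "?p < ?q" "?q < ?r" by auto
  ultimately show "\<exists>p q r. p < q \<and> q < r \<and> r < length w \<and> w ! p = a \<and> w ! q = b \<and> w ! r = c"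
    by blast
next
  assume "\<exists>p q r. p < q \<and> q < r \<and> r < length w \<and> w ! p = a \<and> w ! q = b \<and> w ! r = c"
  then obtain p q r where pqr: "p < q" "q < r" "r < length w"
    and abc: "w ! p = a" "w ! q = b" "w ! r = c" by blast
  \<comment> \<open>The middle position \<open>q\<close> cuts the word, with \<open>p\<close> to its
    left and \<open>r\<close> to its right.\<close>
  have split: "w = take q w @ [b] @ drop (Suc q) w"
    using pqr abc id_take_nth_drop[of q w] by simp
  have "a \<in> set (take q w)" using pqr abc by (auto simp: in_set_conv_nth)
  moreover have "c \<in> set (drop (Suc q) w)"
    using pqr abc by (auto simp: in_set_conv_nth intro!: exI[of _ "r - Suc q"])
  ultimately have "subseq ([a] @ [b] @ [c]) (take q w @ [b] @ drop (Suc q) w)"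
    by (intro list_emb_append_mono) (auto simp: subseq_singleton_left)
  then show "subseq [a, b, c] w" using split by simp
qed

text \<open>Links to the positional condition in \<open>bundled_stirling_perms\<close>; the form
  with subsequences is easier to split along \<open>@\<close>.\<close>

lemma stirling_iff_nth:
  "stirling w \<longleftrightarrow>
     (\<forall>p q r. p < q \<and> q < r \<and> r < length w \<and> w ! p = w ! r \<longrightarrow> w ! p \<le> w ! q)"
  unfolding stirling_def subseq_triple_iff by metis

lemma stirling_infix: "stirling (u @ v @ w) \<Longrightarrow> stirling v"
  unfolding stirling_def by (meson subseq_drop_many subseq_rev_drop_many)

text \<open>A pattern \<open>[a, b, a]\<close> cannot straddle the cut, since both halves would then
  contain \<open>a\<close>.\<close>

lemma stirling_append_disjoint:
  assumes "stirling u" "stirling v" "set u \<inter> set v = {}"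
  shows "stirling (u @ v)"
  unfolding stirling_def
proof (intro allI impI)
  fix a b assume "subseq [a, b, a] (u @ v)"
  then obtain x y where xy: "[a, b, a] = x @ y" "subseq x u" "subseq y v"
    by (rule subseq_appendE)
  have "x = [] \<or> y = []"
  proof (rule ccontr)
    assume "\<not> ?thesis"
    then have "a \<in> set x" "a \<in> set y" using xy(1)
      by (auto simp: Cons_eq_append_conv)
    then have "a \<in> set u" "a \<in> set v" using xy(2,3) by (auto elim: list_emb_set)
    then show False using assms(3) by blast
  qed
  then show "a \<le> b" using xy assms(1,2) by (auto simp: stirling_def)
qed

lemma stirling_Cons_le:
  assumes "stirling w" "\<forall>x\<in>set w. a \<le> x"
  shows "stirling (a # w)"
  unfolding stirling_def
proof (intro allI impI)
  fix c b assume "subseq [c, b, c] (a # w)"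
  then show "c \<le> b"
    \<comment> \<open>If \<open>c = a\<close>, the lower bound on the letters of \<open>w\<close>
      applies; otherwise the pattern lies inside \<open>w\<close>.\<close>
    using assms by (cases "c = a") (auto simp: stirling_def dest!: list_emb_ConsD split: if_splits)
qed

lemma stirling_concat:
  assumes "\<forall>s\<in>set ss. stirling s" "sorted_wrt (\<lambda>s t. set s \<inter> set t = {}) ss"
  shows "stirling (concat ss)"
  using assms
proof (induction ss)
  case Nil
  then show ?case by (simp add: stirling_def)
next
  case (Cons s ss)
  have "set s \<inter> set (concat ss) = {}" using Cons.prems(2) by auto
  then show ?case using Cons by (simp add: stirling_append_disjoint)
qed

lemma stirling_snoc_le:
  assumes "stirling w" "\<forall>x\<in>set w. a \<le> x"
  shows "stirling (w @ [a])"
  unfolding stirling_def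
proof (intro allI impI)
  fix c b assume "subseq [c, b, c] (w @ [a])"
  then obtain x y where xy: "[c, b, c] = x @ y" "subseq x w" "subseq y [a]"
    by (rule subseq_appendE)
  from xy(3) have "y = [] \<or> y = [a]"
    by (cases y) (auto dest: list_emb_ConsD split: if_splits)
  then show "c \<le> b"
  proof
    assume "y = []"
    then show ?thesis using xy assms(1) by (simp add: stirling_def)
  next
    assume "y = [a]"
    then have "x = [a, b]" "c = a" using xy(1) by (auto simp: Cons_eq_append_conv)
    then show ?thesis using xy(2) assms(2) by (auto elim: list_emb_set)
  qed
qed

text \<open>Pieces are added from the right: \<open>s\<close> and \<open>separated a ss\<close>
  share no letter, because \<open>a\<close> lies below every letter of \<open>s\<close>, and the
  \<open>a\<close> then put in front is a least letter.\<close>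

lemma stirling_separated:
  assumes "\<forall>s\<in>set ss. stirling s \<and> (\<forall>x\<in>set s. a < x)"
    and "sorted_wrt (\<lambda>s t. set s \<inter> set t = {}) ss"
  shows "stirling (separated a ss)"
  using assms
proof (induction ss)
  case Nil
  then show ?case by (auto simp: stirling_def dest!: list_emb_ConsD)
next
  case (Cons s ss)
  have "stirling (s @ separated a ss)"
    using Cons by (intro stirling_append_disjoint) (auto simp: set_separated)
  moreover have "\<forall>x\<in>set (s @ separated a ss). a \<le> x"
    using Cons.prems(1) by (auto simp: set_separated intro: less_imp_le)
  ultimately show ?case
    unfolding separated_Cons by (rule stirling_Cons_le)
qed

text \<open>The pattern \<open>[a, c, a]\<close> forces \<open>a \<le> c\<close>, and
  \<open>c\<close> differs from \<open>a\<close>. A further \<open>c\<close> outside would give the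
  pattern \<open>[c, a, c]\<close> and force \<open>c \<le> a\<close>.\<close>

lemma stirling_between:
  assumes "stirling (x @ a # s @ a # y)" "c \<in> set s" "a \<notin> set s"
  shows "a < c" "c \<notin> set x" "c \<notin> set y"
proof -
  have "subseq ([a] @ [c] @ [a]) ((x @ [a]) @ s @ ([a] @ y))"
    using assms(2) by (intro list_emb_append_mono) (auto simp: subseq_singleton_left)
  then have "a \<le> c" using assms(1) by (simp add: stirling_def)
  then show less: "a < c" using assms(2,3) by (cases "a = c") auto
  show "c \<notin> set x"
  proof
    assume "c \<in> set x"
    then have "subseq ([c] @ [a] @ [c]) (x @ [a] @ (s @ a # y))"
      using assms(2) by (intro list_emb_append_mono) (auto simp: subseq_singleton_left)
    then have "c \<le> a" using assms(1) by (simp add: stirling_def)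
    then show False using less by simp
  qed
  show "c \<notin> set y"
  proof
    assume "c \<in> set y"
    then have "subseq ([c] @ [a] @ [c]) ((x @ a # s) @ [a] @ y)"
      using assms(2) by (intro list_emb_append_mono) (auto simp: subseq_singleton_left)
    then have "c \<le> a" using assms(1) by (simp add: stirling_def)
    then show False using less by simp
  qed
qed

section \<open>The code of a tree and of a forest\<close>

primrec block :: "bundled_tree \<Rightarrow> nat list" where
  "block (Node v bs) = separated v (map concat (map (map block) bs))"

definition forest_word :: "bundled_tree list \<Rightarrow> nat list" where
  "forest_word ts = concat (map block ts)"

definition forest_vertices :: "bundled_tree list \<Rightarrow> nat list" where
  "forest_vertices ts = concat (map vertices ts)"

lemma block_Node: "block (Node v bs) = separated v (map forest_word bs)"
  by (simp add: forest_word_def[abs_def] comp_def)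

declare block.simps [simp del]

lemma vertices_Node: "vertices (Node v bs) = v # concat (map forest_vertices bs)"
  by (simp add: vertices_def[abs_def] forest_vertices_def[abs_def] map_concat comp_def)

lemma forest_word_Nil [simp]: "forest_word [] = []"
  and forest_word_Cons [simp]: "forest_word (t # ts) = block t @ forest_word ts"
  by (simp_all add: forest_word_def)

lemma forest_vertices_Nil [simp]: "forest_vertices [] = []"
  and forest_vertices_Cons [simp]: "forest_vertices (t # ts) = vertices t @ forest_vertices ts"
  by (simp_all add: forest_vertices_def)

text \<open>Collects the conditions that are checked vertex by vertex and unfold recursively in
  \<open>increasing_bundled_Node\<close>; the conditions on the collection of all labels are kept
  apart.\<close>

definition increasing_bundled :: "nat \<Rightarrow> bundled_tree \<Rightarrow> bool" where
  "increasing_bundled m t \<longleftrightarrow> increasing t \<and> (\<forall>s\<in>set (subtrees t). length (bundles s) = m)"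

lemma increasing_bundled_Node:
  "increasing_bundled m (Node v bs) \<longleftrightarrow>
     length bs = m \<and> (\<forall>b\<in>set bs. \<forall>t\<in>set b. v < label t \<and> increasing_bundled m t)"
  by (auto simp: increasing_bundled_def increasing_def children_def)

lemma block_nonempty: "block t \<noteq> []"
  by (cases t) (simp add: block_Node separated_def)

lemma label_in_vertices: "label t \<in> set (vertices t)"
  by (cases t) (simp add: vertices_Node)

lemma label_le_vertices:
  "increasing_bundled m t \<Longrightarrow> x \<in> set (vertices t) \<Longrightarrow> label t \<le> x"
proof (induction t)
  case (Node v bs)
  then show ?case
    by (fastforce simp: vertices_Node increasing_bundled_Node forest_vertices_def)
qed

lemma set_block: "set (block t) = set (vertices t)"
proof (induction t)
  case (Node v bs)
  then show ?case
    by (auto simp: block_Node vertices_Node set_separated forest_word_def forest_vertices_def)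
qed

lemma set_forest_word: "set (forest_word ts) = set (forest_vertices ts)"
  by (simp add: forest_word_def forest_vertices_def set_block)

lemma count_list_forest_word_eq:
  assumes "\<And>t. t \<in> set ts \<Longrightarrow> count_list (block t) x = c * count_list (vertices t) x"
  shows "count_list (forest_word ts) x = c * count_list (forest_vertices ts) x"
  using assms by (induction ts) (auto simp: algebra_simps)

text \<open>The \<open>m\<close> bundles of a vertex leave \<open>m + 1\<close> copies of its label
  as separators; the rest follows bundle by bundle. With multiplicities on both sides, distinctness
  of labels can later be read off from letter counts.\<close>

lemma count_list_block:
  "increasing_bundled m t \<Longrightarrow> count_list (block t) x = (m + 1) * count_list (vertices t) x"
proof (induction t)
  case (Node v bs)
  have "count_list (forest_word b) x = (m + 1) * count_list (forest_vertices b) x"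
    if "b \<in> set bs" for b
    using Node that by (intro count_list_forest_word_eq) (auto simp: increasing_bundled_Node)
  then have "(\<Sum>b\<leftarrow>bs. count_list (forest_word b) x) =
      (\<Sum>b\<leftarrow>bs. (m + 1) * count_list (forest_vertices b) x)"
    by (intro arg_cong[of _ _ sum_list] map_cong) auto
  then show ?case using Node.prems
    by (simp add: block_Node vertices_Node count_list_separated count_list_concat comp_def
        increasing_bundled_Node sum_list_addf sum_list_const_mult)
qed

lemma count_list_forest_word:
  "\<forall>t\<in>set ts. increasing_bundled m t \<Longrightarrow>
     count_list (forest_word ts) x = (m + 1) * count_list (forest_vertices ts) x"
  by (intro count_list_forest_word_eq count_list_block) auto

text \<open>Serves to carry disjointness from the vertex lists \<open>f x\<close> over to the words
  \<open>g x\<close>, in which letters repeat.\<close>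

lemma sorted_wrt_disjoint_concat:
  assumes "distinct (concat (map f xs))" "\<And>x. x \<in> set xs \<Longrightarrow> set (g x) = set (f x)"
  shows "sorted_wrt (\<lambda>s t. set s \<inter> set t = {}) (map g xs)"
  using assms by (induction xs) fastforce+

text \<open>Each bundle word is a concatenation of Stirling words with disjoint letters, as the
  labels are distinct; its letters exceed \<open>v\<close>, so \<open>stirling_separated\<close>
  applies.\<close>

lemma stirling_block:
  "increasing_bundled m t \<Longrightarrow> distinct (vertices t) \<Longrightarrow> stirling (block t)"
proof (induction t)
  case (Node v bs)
  have dist: "distinct (concat (map forest_vertices bs))"
    using Node.prems by (simp add: vertices_Node)
  show ?case unfolding block_Node
  proof (rule stirling_separated)
    show "sorted_wrt (\<lambda>s t. set s \<inter> set t = {}) (map forest_word bs)"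
      using dist by (rule sorted_wrt_disjoint_concat) (simp add: set_forest_word)
    have "stirling (forest_word b) \<and> (\<forall>x\<in>set (forest_word b). v < x)" if b: "b \<in> set bs" for b
    proof
      have "distinct (forest_vertices b)"
        using dist b by (auto simp: distinct_concat_iff)
      then have db: "distinct (concat (map vertices b))"
        by (simp add: forest_vertices_def)
      then have "stirling (block t)" if "t \<in> set b" for t
        using Node that b by (auto simp: increasing_bundled_Node distinct_concat_iff)
      moreover have "sorted_wrt (\<lambda>s t. set s \<inter> set t = {}) (map block b)"
        using db by (rule sorted_wrt_disjoint_concat) (simp add: set_block)
      ultimately show "stirling (forest_word b)"
        unfolding forest_word_def by (intro stirling_concat) auto
      show "\<forall>x\<in>set (forest_word b). v < x"
        using Node.prems b label_le_vertices
        by (fastforce simp: forest_word_def set_block increasing_bundled_Node)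
    qed
    then show "\<forall>s\<in>set (map forest_word bs). stirling s \<and> (\<forall>x\<in>set s. v < x)" by auto
  qed
qed

section \<open>Injectivity and surjectivity of the coding of forests\<close>

text \<open>Distinct labels are not needed, as the code of a vertex ends at the (m+1)st occurrence of its label.\<close>

lemma forest_word_inj:
  assumes "\<forall>t\<in>set ts. increasing_bundled m t" "\<forall>t\<in>set us. increasing_bundled m t"
    and "forest_word ts = forest_word us"
  shows "ts = us"
  using assms
proof (induction "length (forest_word ts)" arbitrary: ts us rule: less_induct)
  case less
  show ?case
  proof (cases ts)
    case Nil
    then show ?thesis using less.prems(3) block_nonempty by (cases us) auto
  next
    case ts: (Cons t ts')
    then obtain u us' where us: "us = u # us'"
      using less.prems(3) block_nonempty by (cases us) auto
    obtain v bs where t: "t = Node v bs" by (cases t)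
    obtain v' cs where u: "u = Node v' cs" by (cases u)
    have eq: "separated v (map forest_word bs) @ forest_word ts' =
        separated v' (map forest_word cs) @ forest_word us'"
      using less.prems(3) by (simp add: ts us t u block_Node)
    then have v: "v' = v" by (simp add: separated_def)
    \<comment> \<open>All labels below \<open>v\<close> exceed it, so \<open>v\<close> can serve as
      the delimiter in \<open>separated_prefix_code\<close>.\<close>
    have notin: "v \<notin> set (forest_word b)"
      if "increasing_bundled m (Node v ds)" "b \<in> set ds" for b ds
      using that label_le_vertices
      by (fastforce simp: forest_word_def set_block increasing_bundled_Node)
    have wt: "increasing_bundled m (Node v bs)" and wu: "increasing_bundled m (Node v cs)"
      using less.prems(1,2) by (auto simp: ts us t u v)
    have *: "map forest_word bs = map forest_word cs \<and> forest_word ts' = forest_word us'"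
      using eq notin[OF wt] notin[OF wu] wt wu
      by (intro separated_prefix_code) (auto simp: v increasing_bundled_Node)
    \<comment> \<open>The nonempty \<open>block t\<close> has been removed, so the remaining word is
      shorter.\<close>
    have "ts' = us'"
      using less.prems * block_nonempty[of t] by (intro less.hyps) (auto simp: ts us)
    moreover have "bs = cs"
    \<comment> \<open>Each bundle word is a proper factor of \<open>forest_word ts\<close>, so the
      induction hypothesis makes bundles with equal words equal.\<close>
    proof (rule list.inj_map_strong[of _ _ forest_word forest_word])
      show "map forest_word bs = map forest_word cs" using * ..
      fix b c assume b: "b \<in> set bs" and c: "c \<in> set cs" and "forest_word b = forest_word c"
      moreover have "length (forest_word b) < length (forest_word ts)"
      proof -
        obtain ds es where "bs = ds @ b # es" using b by (auto dest: split_list)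
        then show ?thesis by (simp add: ts t block_Node separated_def)
      qed
      ultimately show "b = c"
        using wt wu by (intro less.hyps) (auto simp: increasing_bundled_Node)
    qed
    ultimately show ?thesis by (simp add: ts us t u v)
  qed
qed

text \<open>Stated for forests because the pieces between copies of the first letter and the
  remainder after its last copy are again codes of forests. By \<open>m \<ge> 1\<close> the first
  letter occurs at least twice.\<close>

lemma exists_forest:
  assumes "stirling w" "\<forall>x\<in>set w. count_list w x = m + 1" "m \<ge> 1"
  shows "\<exists>ts. forest_word ts = w \<and> (\<forall>t\<in>set ts. increasing_bundled m t)"
  using assms(1,2)
proof (induction "length w" arbitrary: w rule: less_induct)
  case less
  show ?case
  proof (cases w)
    case Nil
    then show ?thesis by (intro exI[of _ "[]"]) simp
  next
    case (Cons a v)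
    have "count_list v a = m" using less.prems(2) by (simp add: Cons)
    then have "a \<in> set v" using \<open>m \<ge> 1\<close> count_list_0_iff[of v a] by linarith
    then obtain u w' where v: "v = u @ a # w'" and w': "a \<notin> set w'"
      by (auto dest: split_list_last)
    obtain ss where ss: "a # u @ [a] = separated a ss" "\<forall>s\<in>set ss. a \<notin> set s"
        and "length ss = Suc (count_list u a)"
      using exists_separated[of a u] by blast
    \<comment> \<open>All \<open>m + 1\<close> copies of \<open>a\<close> lie in
      \<open>separated a ss\<close>; they enclose \<open>m\<close> pieces, one for each
      bundle.\<close>
    then have len: "length ss = m"
      using \<open>count_list v a = m\<close> w' by (simp add: v)
    have w: "w = separated a ss @ w'" unfolding Cons v ss(1)[symmetric] by simp
    have seg: "\<exists>ts. forest_word ts = s \<and> (\<forall>t\<in>set ts. increasing_bundled m t \<and> a < label t)"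
      and disj: "set s \<inter> set w' = {}" if s: "s \<in> set ss" for s
    proof -
      \<comment> \<open>For \<open>stirling_between\<close> both copies of \<open>a\<close> around
        \<open>s\<close> must be exposed: the left one ends \<open>separated a ss1\<close>, the
        right one is attached to \<open>s\<close>.\<close>
      obtain ss1 ss2 where "ss = ss1 @ s # ss2" using s by (auto dest: split_list)
      moreover obtain x where "separated a ss1 = x @ [a]"
        using separated_eq_snoc[of a ss1] by blast
      moreover define y where "y = concat (map (\<lambda>s. s @ [a]) ss2)"
      ultimately have w_eq: "w = x @ a # s @ a # y @ w'"
        by (simp add: w separated_append)
      then have st: "stirling (x @ a # s @ a # y @ w')" using less.prems(1) by simp
      have "a \<notin> set s" using ss(2) s by blast
      note btw = stirling_between[OF st _ this]
      then show "set s \<inter> set w' = {}" by auto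
      have "count_list s c = m + 1" if "c \<in> set s" for c
      proof -
        \<comment> \<open>By \<open>btw\<close>, every occurrence of \<open>c\<close> in
          \<open>w\<close> lies in \<open>s\<close>.\<close>
        have "count_list w c = m + 1" using less.prems(2) that by (simp add: w_eq)
        then show ?thesis using btw[OF that] that by (auto simp: w_eq)
      qed
      moreover have "stirling s"
        using stirling_infix[of "x @ [a]" s] st by simp
      moreover have "length s < length w" by (simp add: w_eq)
      ultimately obtain ts where ts: "forest_word ts = s" "\<forall>t\<in>set ts. increasing_bundled m t"
        using less.hyps by blast
      have "a < label t" if "t \<in> set ts" for t
      proof (rule btw(1))
        show "label t \<in> set s"
          using that label_in_vertices[of t] unfolding ts(1)[symmetric]
          by (auto simp: forest_word_def set_block)
      qed
      then show "\<exists>ts. forest_word ts = s \<and> (\<forall>t\<in>set ts. increasing_bundled m t \<and> a < label t)"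
        using ts by blast
    qed
    \<comment> \<open>\<open>g\<close> chooses a forest for every piece; \<open>map g ss\<close>
      becomes the list of bundles of the new root \<open>a\<close>.\<close>
    then obtain g where g: "\<And>s. s \<in> set ss \<Longrightarrow> forest_word (g s) = s \<and>
        (\<forall>t\<in>set (g s). increasing_bundled m t \<and> a < label t)"
      by metis
    have "map forest_word (map g ss) = ss" using g by (simp add: map_idI)
    then have block: "block (Node a (map g ss)) = separated a ss" by (simp only: block_Node)
    have inc: "increasing_bundled m (Node a (map g ss))"
      using g len by (auto simp: increasing_bundled_Node)
    have "count_list w' c = m + 1" if "c \<in> set w'" for c
    proof -
      have "c \<notin> set (separated a ss)" using disj that w' by (auto simp: set_separated)
      moreover have "count_list w c = m + 1" using less.prems(2) that by (simp add: w)
      ultimately show ?thesis by (simp add: w)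
    qed
    moreover have "stirling w'"
      using stirling_infix[of "separated a ss" w' "[]"] less.prems(1) by (simp add: w)
    moreover have "length w' < length w" by (simp add: w separated_def)
    ultimately obtain ts where "forest_word ts = w'" "\<forall>t\<in>set ts. increasing_bundled m t"
      using less.hyps by blast
    then show ?thesis using block inc w
      by (intro exI[of _ "Node a (map g ss) # ts"]) simp
  qed
qed

section \<open>Bundled Stirling permutations and the bijection\<close>

lemma bundled_increasing_trees_iff:
  "t \<in> bundled_increasing_trees m n \<longleftrightarrow>
     increasing_bundled m t \<and> distinct (vertices t) \<and> set (vertices t) = {1..n} \<and> label t = 1"
  by (auto simp: bundled_increasing_trees_def increasing_bundled_def)

lemma count_bundled_stirling_mset:
  assumes "n \<ge> 1"
  shows "count (bundled_stirling_mset k n) x =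
    (if x = 1 then k else if x \<in> {2..n} then k + 2 else 0)"
  unfolding bundled_stirling_mset_def count_union count_sum count_replicate_mset
  by auto

text \<open>Restoring the two outer ones raises the multiplicity of 1 to \<open>k + 2\<close>, like
  that of the other letters, and keeps the Stirling property because 1 is the least letter.\<close>

lemma bundled_stirling_perms_iff:
  assumes "n \<ge> 1"
  shows "w \<in> bundled_stirling_perms k n \<longleftrightarrow> stirling (1 # w @ [1]) \<and>
    (\<forall>x. count_list (1 # w @ [1]) x = (if x \<in> {1..n} then k + 2 else 0))"
proof -
  have "mset w = bundled_stirling_mset k n \<longleftrightarrow>
      (\<forall>x. count_list (1 # w @ [1]) x = (if x \<in> {1..n} then k + 2 else 0))"
    unfolding multiset_eq_iff count_mset count_bundled_stirling_mset[OF assms]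
    by (intro all_cong1) (use assms in auto)
  moreover have "stirling (1 # w @ [1]) \<longleftrightarrow> stirling w" if "mset w = bundled_stirling_mset k n"
  proof
    assume "stirling w"
    have "0 \<notin># mset w"
      by (simp add: that count_bundled_stirling_mset[OF assms] flip: count_eq_zero_iff)
    then have ge: "\<forall>x\<in>set w. 1 \<le> x" by (metis One_nat_def Suc_leI neq0_conv set_mset_mset)
    then show "stirling (1 # w @ [1])" using ge \<open>stirling w\<close>
      by (intro stirling_Cons_le stirling_snoc_le) auto
  next
    assume "stirling (1 # w @ [1])"
    then show "stirling w" using stirling_infix[of "[1]" w "[1]"] by simp
  qed
  moreover have "w \<in> bundled_stirling_perms k n \<longleftrightarrow>
      mset w = bundled_stirling_mset k n \<and> stirling w"
    by (simp add: bundled_stirling_perms_def permutations_of_multiset_def stirling_iff_nth)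
  ultimately show ?thesis by blast
qed

text \<open>With at least one bundle, the first and last letters of the code are two different
  occurrences of the root label, so removing both can be undone.\<close>

lemma block_eq:
  assumes "increasing_bundled m t" "m \<ge> 1"
  shows "block t = label t # butlast (tl (block t)) @ [label t]"
proof -
  obtain v bs where t: "t = Node v bs" by (cases t)
  obtain b bs' where bs: "bs = b # bs'"
    using assms by (cases bs) (auto simp: t increasing_bundled_Node)
  obtain x where "separated v (map forest_word bs') = x @ [v]"
    using separated_eq_snoc[of v "map forest_word bs'"] by blast
  then show ?thesis by (simp add: t bs block_Node separated_Cons butlast_append)
qed

theorem theorem3p13:
  fixes k n :: nat
  assumes "k \<ge> 1" and "n \<ge> 1"
  shows "\<exists>f. bij_betw f (bundled_increasing_trees (k + 1) n) (bundled_stirling_perms k n)"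
proof (intro exI bij_betw_imageI equalityI subsetI)
  let ?f = "\<lambda>t. butlast (tl (block t))" and ?T = "bundled_increasing_trees (k + 1) n"
  have block: "block t = 1 # ?f t @ [1]" if "t \<in> ?T" for t
    using that block_eq[of "k + 1" t] by (simp add: bundled_increasing_trees_iff)
  show "inj_on ?f ?T"
  proof (rule inj_onI)
    fix t u assume tu: "t \<in> ?T" "u \<in> ?T" "?f t = ?f u"
    then have "forest_word [t] = forest_word [u]" using block[of t] block[of u] by simp
    then show "t = u" using tu forest_word_inj[of "[t]" "k + 1" "[u]"]
      by (simp add: bundled_increasing_trees_iff)
  qed
  fix w
  {
    assume "w \<in> ?f ` ?T"
    then obtain t where t: "t \<in> ?T" and w: "w = ?f t" by blast
    have "stirling (block t)" using t stirling_block by (auto simp: bundled_increasing_trees_iff)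
    moreover have "count_list (block t) x = (if x \<in> {1..n} then k + 2 else 0)" for x
      using t count_list_block[of "k + 1" t x]
      by (auto simp: bundled_increasing_trees_iff distinct_count_atmost_1 count_list_0_iff
          simp flip: count_mset)
    ultimately show "w \<in> bundled_stirling_perms k n"
      unfolding bundled_stirling_perms_iff[OF assms(2)] w using block[OF t] by metis
  next
    assume "w \<in> bundled_stirling_perms k n"
    then have st: "stirling (1 # w @ [1])"
      and count: "\<And>x. count_list (1 # w @ [1]) x = (if x \<in> {1..n} then k + 2 else 0)"
      using bundled_stirling_perms_iff[OF assms(2)] by blast+
    have "\<forall>x\<in>set (1 # w @ [1]). count_list (1 # w @ [1]) x = (k + 1) + 1"
      using count count_list_0_iff by (metis add.assoc one_add_one)
    then obtain ts where ts: "forest_word ts = 1 # w @ [1]"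
        "\<forall>t\<in>set ts. increasing_bundled (k + 1) t"
      using exists_forest[OF st] by (metis le_add2)
    \<comment> \<open>Cancelling the factor \<open>k + 2\<close> in the letter counts shows that the
      forest carries each label in \<open>{1..n}\<close> exactly once.\<close>
    have cv: "count_list (forest_vertices ts) x = (if x \<in> {1..n} then 1 else 0)" for x
    proof -
      have "(k + 2) * count_list (forest_vertices ts) x = (if x \<in> {1..n} then k + 2 else 0)"
        using count_list_forest_word[OF ts(2), of x] unfolding ts(1) count by simp
      then show ?thesis
        using mult_cancel1[of "k + 2" "count_list (forest_vertices ts) x" 1] by (auto split: if_splits)
    qed
    obtain t ts' where ts_eq: "ts = t # ts'" using ts(1) by (cases ts) auto
    have inc: "increasing_bundled (k + 1) t" using ts(2) ts_eq by simp
    have bt: "block t = label t # ?f t @ [label t]" using block_eq[OF inc] by simp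
    then have lt: "label t = 1" using ts(1) unfolding ts_eq forest_word_Cons
      by (metis append_Cons list.inject)
    \<comment> \<open>It remains to see that the forest is a single tree. Its first tree uses up the
      only label 1, while the whole word ends in 1, which further trees would have to
      contribute.\<close>
    have "1 \<in> set (vertices t)" using label_in_vertices[of t] lt by simp
    then have "count_list (vertices t) 1 \<noteq> 0" by (simp add: count_list_0_iff)
    then have "count_list (forest_vertices ts') 1 = 0"
      using cv[of 1] assms(2) by (simp add: ts_eq)
    then have "1 \<notin> set (forest_vertices ts')" by (simp add: count_list_0_iff)
    moreover have "1 \<in> set (forest_word ts')" if "forest_word ts' \<noteq> []"
    proof -
      have "last (forest_word ts') = 1"
        using arg_cong[OF ts(1), of last] that by (simp add: ts_eq)
      then show ?thesis using last_in_set[OF that] by simp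
    qed
    ultimately have "forest_word ts' = []" by (auto simp: set_forest_word)
    then have "ts' = []"
      using block_nonempty by (cases ts') auto
    then have bl: "block t = 1 # w @ [1]"
      and cv: "\<And>x. count_list (vertices t) x = (if x \<in> {1..n} then 1 else 0)"
      using ts(1) cv by (simp_all add: ts_eq)
    have "x \<in> set (vertices t) \<longleftrightarrow> x \<in> {1..n}" for x
      using cv[of x] count_list_0_iff[of "vertices t" x] by (auto split: if_splits)
    then have set: "set (vertices t) = {1..n}" by blast
    moreover have "distinct (vertices t)"
      unfolding distinct_count_atmost_1 count_mset set using cv by blast
    ultimately have "t \<in> ?T" using inc lt by (simp add: bundled_increasing_trees_iff)
    moreover have "?f t = w" using bl by simp
    ultimately show "w \<in> ?f ` ?T" by blast
  }
qed

end
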